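(* Let $a,b\geq 1$ be integers with $\gcd(a,b)=1$. If $(a,b)$ is one of $(29,1)$, $(45,1)$, $(47,1)$, $(50,1)$, $(55,1)$, $(67,1)$, $(73,1)$, $(79,1)$, then $$e(S(a,b))=\lceil f(a)\rceil.$$ For all other such $(a,b)$, $$e(S(a,b))=\lceil f(a)\rceil-1.$$
   Context: $\mathbb{N}_0=\{0,1,2,\ldots\}$ and $\binom{n}{2}=\frac{n(n-1)}{2}$. For $a,b\in\mathbb{N}_0$, $S(a,b)$ is the submonoid of $(\mathbb{N}_0,+)$ generated by $\left\{na+\binom{n}{2}b : n\in\mathbb{N}_0\right\}$; it is a numerical semigroup (a submonoid of $\mathbb{N}_0$ with finite complement) exactly when $\gcd(a,b)=1$. Every numerical semigroup $S$ has a unique, finite, minimal system of generators (a generating set no proper subset of which generates $S$); its cardinality is the embedding dimension $e(S)$. The function $f$ is given by $f(x)=\frac{1+\sqrt{8x+1}}{2}$. *)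

theory Defs
  imports Complex_Main
begin

definition add_submonoid :: "nat set \<Rightarrow> bool" where
  "add_submonoid M \<longleftrightarrow> 0 \<in> M \<and> (\<forall>x\<in>M. \<forall>y\<in>M. x + y \<in> M)"

definition generated_submonoid :: "nat set \<Rightarrow> nat set" where
  "generated_submonoid X = add_submonoid hull X"

definition S_monoid :: "nat \<Rightarrow> nat \<Rightarrow> nat set" where
  "S_monoid a b = generated_submonoid {n * a + (n choose 2) * b | n. True}"

definition minimal_generating_system :: "nat set \<Rightarrow> nat set \<Rightarrow> bool" where
  "minimal_generating_system M A \<longleftrightarrow>
     generated_submonoid A = M \<and> (\<forall>B. B \<subset> A \<longrightarrow> generated_submonoid B \<noteq> M)"

text \<open>
  Every numerical semigroup has exactly one minimal system of generators, and it is finite,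
  so for such \<open>M\<close> the description operator and \<^const>\<open>card\<close> below
  do not return their default values.
\<close>

definition embedding_dimension :: "nat set \<Rightarrow> nat" where
  "embedding_dimension M = card (THE A. minimal_generating_system M A)"

definition f :: "real \<Rightarrow> real" where
  "f x = (1 + sqrt (8 * x + 1)) / 2"

end

(*
  Write T n = n choose 2 and g n = n a + T n b.  The minimal generators of a submonoid of the
  naturals are its irreducible elements, so they are among the g n.  As gcd a b = 1 and T is
  superadditive, g n is reducible iff for some k >= 1 the number t = T n - k a is nonnegative and is
  a sum of triangular numbers T (n_i) with sum of the n_i equal to n + k b.  In particular g n is
  irreducible when T n < a, that is, when n < f a.  When T n >= a, take t = T n mod a, so that
  2 t < T n.  Splitting off the largest triangular number T x <= t leaves a remainder r < x, for
  which a crude linear bound on the sum of the n_i suffices: the total is at most n + 1 if t >= 210.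
  The remaining t are settled by a table; exactly eight pairs (t, n) fail, they force a = T n - t,
  and n + 2 is enough for them, so that they only matter for b = 1.
*)
theory Submission
  imports Defs "HOL-Library.Code_Binary_Nat"
begin

section \<open>Irreducible elements and minimal generating systems\<close>

definition irreducibles :: "nat set \<Rightarrow> nat set" where
  "irreducibles M = {x \<in> M. x \<noteq> 0 \<and> (\<forall>y\<in>M. \<forall>z\<in>M. x = y + z \<longrightarrow> y = 0 \<or> z = 0)}"

lemma add_submonoid_generated: "add_submonoid (generated_submonoid X)"
  unfolding generated_submonoid_def
  by (rule hull_in) (auto simp: add_submonoid_def)

lemma subset_generated: "X \<subseteq> generated_submonoid X"
  unfolding generated_submonoid_def by (rule hull_subset)

lemma generated_minimal: "X \<subseteq> M \<Longrightarrow> add_submonoid M \<Longrightarrow> generated_submonoid X \<subseteq> M"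
  unfolding generated_submonoid_def by (rule hull_minimal)

text \<open>Deleting an irreducible \<open>x\<close> from \<open>M\<close> leaves a submonoid, so a
  set of generators that misses \<open>x\<close> could not reach it.\<close>

lemma irreducibles_subset_generators:
  assumes "generated_submonoid X = M"
  shows "irreducibles M \<subseteq> X"
proof
  fix x assume x: "x \<in> irreducibles M"
  show "x \<in> X"
  proof (rule ccontr)
    assume "x \<notin> X"
    have M: "add_submonoid M" "X \<subseteq> M"
      using add_submonoid_generated subset_generated assms by auto
    have "add_submonoid (M - {x})"
      unfolding add_submonoid_def
    proof (intro conjI ballI)
      show "0 \<in> M - {x}" using M(1) x by (auto simp: add_submonoid_def irreducibles_def)
    next
      fix y z assume yz: "y \<in> M - {x}" "z \<in> M - {x}"
      then have "y + z \<in> M" using M(1) by (auto simp: add_submonoid_def)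
      moreover have "y + z \<noteq> x"
      proof
        assume "y + z = x"
        moreover from this have "y = 0 \<or> z = 0" using x yz unfolding irreducibles_def by blast
        ultimately show False using yz by auto
      qed
      ultimately show "y + z \<in> M - {x}" by blast
    qed
    moreover have "X \<subseteq> M - {x}" using M(2) \<open>x \<notin> X\<close> by auto
    ultimately have "M \<subseteq> M - {x}" using generated_minimal[of X] assms by blast
    with x show False by (auto simp: irreducibles_def)
  qed
qed

text \<open>A nonzero element that is not irreducible splits into two strictly smaller elements of
  \<open>M\<close>, so strong induction applies.\<close>

lemma generated_irreducibles:
  assumes "add_submonoid M"
  shows "generated_submonoid (irreducibles M) = M"
proof
  show "generated_submonoid (irreducibles M) \<subseteq> M"
    by (rule generated_minimal) (use assms in \<open>auto simp: irreducibles_def\<close>)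
  have G: "add_submonoid (generated_submonoid (irreducibles M))"
    by (rule add_submonoid_generated)
  have "x \<in> generated_submonoid (irreducibles M)" if "x \<in> M" for x
    using that
  proof (induction x rule: less_induct)
    case (less x)
    consider "x = 0" | "x \<in> irreducibles M"
      | y z where "y \<in> M" "z \<in> M" "x = y + z" "y \<noteq> 0" "z \<noteq> 0"
      using less.prems unfolding irreducibles_def by blast
    then show ?case
    proof cases
      case 1 then show ?thesis using G by (simp add: add_submonoid_def)
    next
      case 2 then show ?thesis using subset_generated by blast
    next
      case 3 then show ?thesis using G less.IH[of y] less.IH[of z] by (simp add: add_submonoid_def)
    qed
  qed
  then show "M \<subseteq> generated_submonoid (irreducibles M)" by blast
qed

lemma embedding_dimension_eq_card_irreducibles:
  assumes "add_submonoid M"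
  shows "embedding_dimension M = card (irreducibles M)"
proof -
  have "minimal_generating_system M A \<longleftrightarrow> A = irreducibles M" for A
    unfolding minimal_generating_system_def
    using generated_irreducibles[OF assms] irreducibles_subset_generators
    by (metis psubset_eq subset_antisym)
  then show ?thesis by (simp add: embedding_dimension_def)
qed

section \<open>Sums of triangular numbers with prescribed index sum\<close>

text \<open>
  \<open>tri_sum N t\<close>: \<open>t\<close> is a sum of triangular numbers \<open>n\<^sub>i choose 2\<close> with \<open>N = \<Sum>n\<^sub>i\<close>.
  As \<open>1 choose 2 = 0\<close>, summands \<open>n\<^sub>i = 1\<close> only increase \<open>N\<close>.
\<close>
inductive tri_sum :: "nat \<Rightarrow> nat \<Rightarrow> bool" where
  zero: "tri_sum 0 0"
| add: "tri_sum N t \<Longrightarrow> tri_sum (N + n) (t + (n choose 2))"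

lemma tri_sum_plus:
  assumes "tri_sum N t" "tri_sum N' t'"
  shows "tri_sum (N + N') (t + t')"
  using assms(2)
proof induction
  case zero
  then show ?case using assms(1) by simp
next
  case (add N' t' n)
  then show ?case using tri_sum.add[OF add.IH, of n] by (simp add: add.assoc)
qed

lemma tri_sum_single: "tri_sum n (n choose 2)"
  using tri_sum.add[OF tri_sum.zero, of n] by simp

lemma tri_sum_mono:
  assumes "tri_sum N t" "N \<le> N'"
  shows "tri_sum N' t"
  using assms(2)
proof (induction N' rule: dec_induct)
  case base
  show ?case by (rule assms(1))
next
  case (step N')
  then show ?case using tri_sum.add[of N' t 1] by (simp add: numeral_2_eq_2)
qed

lemma choose_two_add: "(m + n) choose 2 = (m choose 2) + (n choose 2) + m * n"
proof (induction n)
  case (Suc n)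
  then show ?case by (simp add: numeral_2_eq_2)
qed (simp add: numeral_2_eq_2)

lemma choose_two_mono: "m \<le> n \<Longrightarrow> m choose 2 \<le> n choose 2"
  by (rule binomial_right_mono)

lemma twice_choose_two: "2 * int (n choose 2) = int n * (int n - 1)"
proof (induction n)
  case (Suc n)
  then show ?case by (simp add: numeral_2_eq_2 algebra_simps)
qed (simp add: numeral_2_eq_2)

lemma tri_sum_le: "tri_sum N t \<Longrightarrow> t \<le> N choose 2"
  by (induction rule: tri_sum.induct) (auto simp: choose_two_add)

text \<open>A single summand attains the bound of \<open>tri_sum_le\<close>; any other value needs
  two parts with positive index sums, which later become two nonzero elements of the monoid.\<close>

lemma tri_sum_split:
  assumes "tri_sum N t"
  shows "t = N choose 2 \<or> (\<exists>N1 N2 t1 t2. N = N1 + N2 \<and> t = t1 + t2 \<and>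
           tri_sum N1 t1 \<and> tri_sum N2 t2 \<and> N1 > 0 \<and> N2 > 0)"
  using assms
proof induction
  case zero
  show ?case by simp
next
  case (add N t n)
  consider "N = 0" | "n = 0" | "N > 0" "n > 0" by blast
  then show ?case
  proof cases
    case 1
    then have "t = 0" using tri_sum_le[OF add.hyps] by (simp add: numeral_2_eq_2)
    then show ?thesis using 1 by simp
  next
    case 2
    then have "N + n = N" "t + (n choose 2) = t" by simp_all
    then show ?thesis using add.IH by presburger
  next
    case 3
    then show ?thesis using add.hyps tri_sum_single by blast
  qed
qed

section \<open>Reducibility of the generators of \<open>S_monoid a b\<close>\<close>

lemma S_monoid_eq: "S_monoid a b = {N * a + t * b | N t. tri_sum N t}" (is "_ = ?R")
proof
  have "add_submonoid ?R"
    unfolding add_submonoid_def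
  proof (intro conjI ballI)
    show "0 \<in> ?R" using tri_sum.zero by force
  next
    fix x y assume "x \<in> ?R" "y \<in> ?R"
    then obtain N t N' t' where "x = N * a + t * b" "y = N' * a + t' * b" "tri_sum N t" "tri_sum N' t'"
      by blast
    moreover from this have "x + y = (N + N') * a + (t + t') * b" by (simp add: algebra_simps)
    ultimately show "x + y \<in> ?R" using tri_sum_plus by blast
  qed
  moreover have "{n * a + (n choose 2) * b | n. True} \<subseteq> ?R" using tri_sum_single by blast
  ultimately show "S_monoid a b \<subseteq> ?R" unfolding S_monoid_def by (rule generated_minimal[rotated])
next
  have G: "add_submonoid (S_monoid a b)" unfolding S_monoid_def by (rule add_submonoid_generated)
  have g: "n * a + (n choose 2) * b \<in> S_monoid a b" for n
    unfolding S_monoid_def by (rule subsetD[OF subset_generated]) blast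
  have "N * a + t * b \<in> S_monoid a b" if "tri_sum N t" for N t
    using that
  proof induction
    case zero
    then show ?case using G by (simp add: add_submonoid_def)
  next
    case (add N t n)
    then have "(N * a + t * b) + (n * a + (n choose 2) * b) \<in> S_monoid a b"
      using G g[of n] unfolding add_submonoid_def by blast
    then show ?case by (simp add: algebra_simps)
  qed
  then show "?R \<subseteq> S_monoid a b" by blast
qed

definition generator_reducible :: "nat \<Rightarrow> nat \<Rightarrow> nat \<Rightarrow> bool" where
  "generator_reducible a b n \<longleftrightarrow> (\<exists>k t. k \<ge> 1 \<and> n choose 2 = k * a + t \<and> tri_sum (n + k * b) t)"

lemma irreducible_iff:
  assumes "a \<ge> 1" "b \<ge> 1" "gcd a b = 1"
  shows "n * a + (n choose 2) * b \<in> irreducibles (S_monoid a b) \<longleftrightarrow> n \<ge> 1 \<and> \<not> generator_reducible a b n"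
    (is "?g \<in> _ \<longleftrightarrow> _")
proof -
  have gS: "?g \<in> S_monoid a b" using S_monoid_eq tri_sum_single by blast
  have 1: "?g \<notin> irreducibles (S_monoid a b)" if red: "generator_reducible a b n"
  proof -
    obtain k t where kt: "k \<ge> 1" "n choose 2 = k * a + t" "tri_sum (n + k * b) t"
      using red unfolding generator_reducible_def by blast
    have "k * a \<ge> 1" using kt(1) assms(1) by simp
    \<comment> \<open>This strict inequality rules out the one-summand alternative of
      \<open>tri_sum_split\<close>.\<close>
    then have "t < n choose 2" using kt(2) by linarith
    moreover have "n choose 2 \<le> (n + k * b) choose 2" by (rule choose_two_mono) simp
    ultimately obtain N1 N2 t1 t2 where s: "n + k * b = N1 + N2" "t = t1 + t2"
      "tri_sum N1 t1" "tri_sum N2 t2" "N1 > 0" "N2 > 0"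
      using tri_sum_split[OF kt(3)] by auto
    have "?g = (n + k * b) * a + t * b" using kt(2) by (simp add: algebra_simps)
    also have "\<dots> = (N1 * a + t1 * b) + (N2 * a + t2 * b)"
      unfolding s(1,2) by (simp add: algebra_simps)
    finally have "?g = (N1 * a + t1 * b) + (N2 * a + t2 * b)" .
    moreover have "N1 * a + t1 * b \<in> S_monoid a b" "N2 * a + t2 * b \<in> S_monoid a b"
      using s S_monoid_eq by blast+
    moreover have "N1 * a + t1 * b \<noteq> 0" "N2 * a + t2 * b \<noteq> 0" using s assms(1) by auto
    ultimately show ?thesis unfolding irreducibles_def by (smt (verit) mem_Collect_eq)
  qed
  have 2: "generator_reducible a b n" if n: "n \<ge> 1" and red: "?g \<notin> irreducibles (S_monoid a b)"
  proof -
    have "?g \<noteq> 0" using n assms by simp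
    then obtain y z where yz: "y \<in> S_monoid a b" "z \<in> S_monoid a b" "?g = y + z" "y \<noteq> 0" "z \<noteq> 0"
      using red gS unfolding irreducibles_def by blast
    obtain N1 t1 N2 t2 where s: "y = N1 * a + t1 * b" "z = N2 * a + t2 * b"
      "tri_sum N1 t1" "tri_sum N2 t2"
      using yz(1,2) unfolding S_monoid_eq by blast
    have pos: "N1 > 0" "N2 > 0"
      using s yz(4,5) tri_sum_le[OF s(3)] tri_sum_le[OF s(4)]
      by (auto intro!: Nat.gr0I simp: numeral_2_eq_2)
    define N t where "N = N1 + N2" and "t = t1 + t2"
    have tri: "tri_sum N t" unfolding N_def t_def using s(3,4) by (rule tri_sum_plus)
    have eq: "n * a + (n choose 2) * b = N * a + t * b"
      using yz(3) s unfolding N_def t_def by (simp add: algebra_simps)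
    \<comment> \<open>The cross term \<open>N1 * N2\<close> in \<open>choose_two_add\<close> makes
      the bound on \<open>t\<close> strict.\<close>
    have "N1 * N2 > 0" using pos by simp
    then have tlt: "t < N choose 2"
      using tri_sum_le[OF s(3)] tri_sum_le[OF s(4)] unfolding N_def t_def choose_two_add by linarith
    have "n < N"
    proof (rule ccontr)
      assume "\<not> n < N"
      then have "N * a \<le> n * a" "N choose 2 \<le> n choose 2" by (auto intro: choose_two_mono)
      then have "t * b < (n choose 2) * b" using tlt assms(2) by simp
      with \<open>N * a \<le> n * a\<close> eq show False by linarith
    qed
    then have "t * b < (n choose 2) * b"
      using eq mult_strict_right_mono[of n N a] assms(1) by linarith
    then have tn: "t < n choose 2" by simp
    have diff: "(N - n) * a = ((n choose 2) - t) * b"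
      using eq \<open>n < N\<close> tn by (simp add: diff_mult_distrib)
    \<comment> \<open>Coprimality turns the equality of the two representations into
      \<open>N = n + k * b\<close> and \<open>t = (n choose 2) - k * a\<close>.\<close>
    then have "b dvd (N - n) * a" by simp
    moreover have "coprime b a" using assms(3) by (simp add: coprime_iff_gcd_eq_1 gcd.commute)
    ultimately have "b dvd N - n" by (simp add: coprime_dvd_mult_left_iff)
    then obtain k where k: "N - n = k * b" by (metis dvdE mult.commute)
    have "(k * a) * b = ((n choose 2) - t) * b" using diff k by (simp add: algebra_simps)
    then have ka: "k * a = (n choose 2) - t" using assms(2) by simp
    have "k \<ge> 1" using k \<open>n < N\<close> by (cases k) auto
    moreover have "n choose 2 = k * a + t" using ka tn by simp
    moreover have "N = n + k * b" using k \<open>n < N\<close> by simp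
    ultimately show ?thesis unfolding generator_reducible_def using tri by blast
  qed
  have 3: "n \<ge> 1" if "?g \<in> irreducibles (S_monoid a b)"
    using that by (cases n) (auto simp: irreducibles_def numeral_2_eq_2)
  show ?thesis using 1 2 3 by blast
qed

lemma embedding_dimension_S_monoid:
  assumes "a \<ge> 1" "b \<ge> 1" "gcd a b = 1"
  shows "embedding_dimension (S_monoid a b) = card {n. n \<ge> 1 \<and> \<not> generator_reducible a b n}"
    (is "_ = card ?I")
proof -
  let ?g = "\<lambda>n. n * a + (n choose 2) * b"
  have "irreducibles (S_monoid a b) \<subseteq> {?g n | n. True}"
    by (rule irreducibles_subset_generators) (simp add: S_monoid_def)
  then have "irreducibles (S_monoid a b) = ?g ` ?I"
    using irreducible_iff[OF assms] by (auto simp: image_iff)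
  moreover have "strict_mono ?g"
    by (rule strict_monoI)
       (use assms(1) in \<open>simp add: add_less_le_mono choose_two_mono\<close>)
  then have "inj_on ?g ?I" by (meson strict_mono_imp_inj_on inj_on_subset subset_UNIV)
  moreover have "add_submonoid (S_monoid a b)"
    unfolding S_monoid_def by (rule add_submonoid_generated)
  ultimately show ?thesis
    by (simp add: embedding_dimension_eq_card_irreducibles card_image)
qed

section \<open>Finite tables for small \<open>t\<close>\<close>

text \<open>The entry with index \<open>t\<close> is the least \<open>N\<close> with \<open>tri_sum N t\<close>.\<close>
definition tri_table :: "nat list" where
  "tri_table =
   [0, 2, 4, 3, 5, 7, 4, 6, 8, 7, 5, 7, 8, 8, 10, 6, 8, 10, 9, 11, 10, 7, 9, 11, 10, 11, 13, 11, 8, 10,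
    12, 11, 13, 15, 12, 14, 9, 11, 13, 12, 14, 16, 13, 14, 16, 10, 12, 14, 13, 15, 17, 14, 16, 18, 17, 11, 13, 15, 14, 16,
    16, 15, 17, 19, 17, 16, 12, 14, 16, 15, 17, 19, 16, 18, 20, 19, 17, 19, 13, 15, 17, 16, 18, 19, 17, 19, 21, 19, 18, 20,
    20, 14, 16, 18, 17, 19, 21, 18, 20, 20, 21, 19, 21, 22, 22, 15, 17, 19, 18, 20, 22, 19, 21, 23, 22, 20, 22, 23, 23, 22,
    16, 18, 20, 19, 21, 23, 20, 22, 24, 23, 21, 23, 24, 23, 25, 22, 17, 19, 21, 20, 22, 23, 21, 23, 25, 24, 22, 24, 24, 25,
    25, 23, 25, 18, 20, 22, 21, 23, 25, 22, 24, 26, 25, 23, 25, 26, 26, 28, 24, 26, 28, 19, 21, 23, 22, 24, 26, 23, 25, 27,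
    26, 24, 26, 27, 27, 29, 25, 27, 29, 27, 20, 22, 24, 23, 25, 27, 24, 26, 28, 27, 25, 27, 28, 28, 30, 26, 28, 28, 29, 31]"

text \<open>The entry with index \<open>t > 0\<close> is a summand \<open>n\<^sub>i\<close> of an optimal decomposition of \<open>t\<close>.\<close>
definition tri_summands :: "nat list" where
  "tri_summands =
   [0, 2, 2, 3, 3, 3, 4, 4, 4, 4, 5, 5, 4, 5, 5, 6, 6, 6, 6, 6, 5, 7, 7, 7, 7, 6, 6, 7, 8, 8,
    8, 8, 8, 8, 8, 8, 9, 9, 9, 9, 9, 9, 9, 8, 8, 10, 10, 10, 10, 10, 10, 10, 10, 10, 10, 11, 11, 11, 11, 11,
    10, 11, 11, 11, 9, 11, 12, 12, 12, 12, 12, 12, 12, 12, 12, 12, 12, 12, 13, 13, 13, 13, 13, 11, 13, 13, 13, 12, 13, 13,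
    10, 14, 14, 14, 14, 14, 14, 14, 14, 13, 14, 14, 14, 14, 14, 15, 15, 15, 15, 15, 15, 15, 15, 15, 15, 15, 15, 15, 15, 14,
    16, 16, 16, 16, 16, 16, 16, 16, 16, 16, 16, 16, 16, 15, 15, 16, 17, 17, 17, 17, 17, 16, 17, 17, 17, 17, 17, 17, 16, 17,
    15, 17, 17, 18, 18, 18, 18, 18, 18, 18, 18, 18, 18, 18, 18, 18, 18, 18, 18, 18, 18, 19, 19, 19, 19, 19, 19, 19, 19, 19,
    19, 19, 19, 19, 19, 19, 19, 19, 19, 18, 20, 20, 20, 20, 20, 20, 20, 20, 20, 20, 20, 20, 20, 20, 20, 20, 20, 19, 20, 20]"

text \<open>The pairs \<open>(t, n)\<close> with \<open>2 * t < n choose 2\<close> for which \<open>tri_sum (n + 1) t\<close> fails.\<close>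
definition bad_pairs :: "(nat \<times> nat) list" where
  "bad_pairs = [(26, 11), (33, 13), (41, 14), (44, 14), (50, 15), (53, 16), (63, 17), (74, 18)]"

lemma length_tri_table [simp]: "length tri_table = 210" "length tri_summands = 210"
  by (simp_all add: tri_table_def tri_summands_def)

text \<open>Certificate for the upper bounds: removing the listed summand \<open>x\<close> leads to
  an earlier entry, as \<open>x \<ge> 2\<close> makes the index drop.\<close>

lemma tri_table_upper_check:
  "list_all (\<lambda>(t, N, x). t = 0 \<or> x \<ge> 2 \<and> x * (x - 1) div 2 \<le> t \<and>
      tri_table ! (t - x * (x - 1) div 2) + x \<le> N) (zip [0..<210] (zip tri_table tri_summands))"
  by code_simp

text \<open>Adding a summand \<open>x\<close> lowers no entry below its minimum: the zip pairs index
  \<open>t + (x choose 2)\<close> with index \<open>t\<close>. Indices below 75 cover all bad pairs,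
  and there \<open>x < 13\<close> because \<open>13 choose 2 = 78\<close>.\<close>

lemma tri_table_lower_check:
  "list_all (\<lambda>x. list_all (\<lambda>(M, N). M \<le> N + x)
      (zip (drop (x * (x - 1) div 2) (take 75 tri_table)) tri_table)) [0..<13]"
  by code_simp

text \<open>The bound \<open>n + 1\<close> fails only for \<open>n \<le> N - 2\<close>. Either
  \<open>N - 2\<close> already violates \<open>2 * t < n choose 2\<close>, or it gives a bad pair
  and \<open>N - 3\<close> violates it.\<close>

lemma tri_table_bad_check:
  "list_all (\<lambda>(t, N). N < 2 \<or> (N - 2) * (N - 3) \<le> 4 * t \<or>
      (t, N - 2) \<in> set bad_pairs \<and> (N - 3) * (N - 4) \<le> 4 * t)
    (zip [0..<210] tri_table)"
  by code_simp

text \<open>The constant 27 is attained at \<open>t = 33\<close>, where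
  \<open>N = 15\<close>.\<close>

lemma tri_table_linear_check: "list_all (\<lambda>(t, N). 4 * N \<le> t + 27) (zip [0..<36] tri_table)"
  by code_simp

lemma bad_pairs_check:
  "list_all (\<lambda>(t, n). t < 75 \<and> tri_table ! t = n + 2 \<and>
      2 * t < n * (n - 1) div 2 \<and> n * (n - 1) div 2 \<le> 3 * t + 1) bad_pairs"
  by code_simp

lemma tri_sum_table:
  assumes "t < 210"
  shows "tri_sum (tri_table ! t) t"
  using assms
proof (induction t rule: less_induct)
  case (less t)
  show ?case
  proof (cases "t = 0")
    case True
    then show ?thesis using tri_sum.zero by (simp add: tri_table_def)
  next
    case False
    define x where "x = tri_summands ! t"
    have x: "x \<ge> 2" "x choose 2 \<le> t" "tri_table ! (t - (x choose 2)) + x \<le> tri_table ! t"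
      using tri_table_upper_check less.prems False
      by (auto simp: list_all_length choose_two x_def)
    have "x choose 2 \<ge> 2 choose 2" using x(1) by (rule choose_two_mono)
    then have "t - (x choose 2) < t" using x(2) by simp
    then have "tri_sum (tri_table ! (t - (x choose 2)) + x) (t - (x choose 2) + (x choose 2))"
      using less by (intro tri_sum.add) simp
    then show ?thesis using x by (auto intro: tri_sum_mono)
  qed
qed

text \<open>Induction over the decomposition, with \<open>tri_table_lower_check\<close> as the step;
  this is what proves the exceptions genuine.\<close>

lemma tri_table_le:
  assumes "tri_sum N t" "t < 75"
  shows "tri_table ! t \<le> N"
  using assms
proof induction
  case zero
  then show ?case by (simp add: tri_table_def)
next
  case (add N t n)
  have "n < 13"
  proof (rule ccontr)
    assume "\<not> n < 13"
    then have "13 choose 2 \<le> n choose 2" by (intro choose_two_mono) simp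
    then show False using add.prems by (simp add: choose_two)
  qed
  then have "tri_table ! (t + (n choose 2)) \<le> tri_table ! t + n"
    using tri_table_lower_check add.prems by (auto simp: list_all_length choose_two add.commute)
  then show ?case using add by simp
qed

section \<open>Greedy decomposition of large \<open>t\<close>\<close>

text \<open>Splitting off copies of \<open>36 = 9 choose 2\<close> gives the slope \<open>9/36\<close>.\<close>
lemma tri_sum_linear_bound: "\<exists>N. tri_sum N t \<and> 4 * N \<le> t + 27"
proof (induction t rule: less_induct)
  case (less t)
  show ?case
  proof (cases "t < 36")
    case True
    then show ?thesis using tri_table_linear_check tri_sum_table[of t] by (auto simp: list_all_length)
  next
    case False
    then obtain N where N: "tri_sum N (t - 36)" "4 * N \<le> t - 36 + 27"
      using less[of "t - 36"] by auto
    have "tri_sum (N + 9) t" using tri_sum.add[OF N(1), of 9] False by (simp add: choose_two)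
    moreover have "4 * (N + 9) \<le> t + 27" using N(2) False by simp
    ultimately show ?thesis by blast
  qed
qed

lemma triangular_floor: "\<exists>x r. t = r + (x choose 2) \<and> r < x"
proof (induction t)
  case 0
  show ?case by (rule exI[of _ 1]) (simp add: numeral_2_eq_2)
next
  case (Suc t)
  then obtain x r where x: "t = r + (x choose 2)" "r < x" by blast
  show ?case
  proof (cases "Suc r < x")
    case True
    then show ?thesis using x(1) by (metis add_Suc)
  next
    case False
    then have "Suc t = 0 + (Suc x choose 2)" using x by (simp add: numeral_2_eq_2)
    then show ?thesis by blast
  qed
qed

text \<open>If the bound failed, \<open>n\<close> would be at most about
  \<open>x + r/4 < 5x/4\<close>, so \<open>n * n\<close> would be roughly at most
  \<open>25/16 * x * x\<close>, while \<open>A > 2 * B\<close> forces about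
  \<open>2 * x * x\<close>.\<close>

lemma greedy_length_bound:
  fixes A B n x r N :: nat
  assumes "2 * int A = int n * (int n - 1)" "2 * int B = int x * (int x - 1)"
    and "2 * (r + B) < A" "r < x" "x \<ge> 21" "4 * N \<le> r + 27"
  shows "N + x \<le> n + 1"
proof (rule ccontr)
  define n' x' r' where "n' = int n" and "x' = int x" and "r' = int r"
  assume "\<not> N + x \<le> n + 1"
  then have up: "4 * n' \<le> 4 * x' + r' + 19" using assms(6) unfolding n'_def x'_def r'_def by linarith
  have r: "0 \<le> r'" "r' \<le> x' - 1" "21 \<le> x'" using assms(4,5) by (auto simp: r'_def x'_def)
  have low: "n' * (n' - 1) \<ge> 4 * r' + 2 * (x' * (x' - 1)) + 2"
  proof -
    have "4 * int r + 2 * (2 * int B) + 2 \<le> 2 * int A" using assms(3) by simp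
    then show ?thesis unfolding assms(1,2) n'_def x'_def r'_def .
  qed
  have "x' * (x' - 1) \<ge> 0" using r by simp
  then have "n' * (n' - 1) > 0" using low r(1) by linarith
  then have "n' \<noteq> 0" by auto
  then have "n' \<ge> 1" unfolding n'_def by simp
  then have "(4 * n') * (4 * n' - 4) \<le> (4 * x' + r' + 19) * (4 * x' + r' + 15)"
    using up r by (intro mult_mono) auto
  then have 1: "64 * r' + 32 * (x' * x') - 32 * x' + 32
      \<le> 16 * (x' * x') + 136 * x' + 8 * (x' * r') + r' * r' + 34 * r' + 285"
    using low by (simp add: algebra_simps)
  have 2: "r' * r' \<le> (x' - 1) * r'" "0 \<le> (x' - 1 - r') * (9 * x' - 31)" "21 * x' \<le> x' * x'"
    using r by (auto intro!: mult_right_mono mult_nonneg_nonneg)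
  \<comment> \<open>Eliminating \<open>r'\<close> leaves
    \<open>7 * x' * x' - 128 * x' - 284 \<le> 0\<close>, which is false from \<open>x' = 21\<close>
    on; hence the threshold \<open>210 = 21 choose 2\<close>.\<close>
  show False using 1 2 r by (simp add: algebra_simps)
qed

lemma tri_sum_large:
  assumes "t \<ge> 210" "n choose 2 > 2 * t"
  shows "tri_sum (n + 1) t"
proof -
  obtain x r where r: "t = r + (x choose 2)" "r < x" using triangular_floor by blast
  have x2: "x \<ge> 21"
  proof (rule ccontr)
    assume "\<not> x \<ge> 21"
    then have "Suc x choose 2 \<le> 21 choose 2" by (intro choose_two_mono) simp
    then show False using r assms(1) choose_two_add[of x 1] by (simp add: choose_two)
  qed
  obtain N where N: "tri_sum N r" "4 * N \<le> r + 27" using tri_sum_linear_bound by blast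
  have "N + x \<le> n + 1"
    using greedy_length_bound[OF twice_choose_two twice_choose_two] assms(2) r x2 N(2) by blast
  then show ?thesis
    using tri_sum_mono[OF tri_sum.add[OF N(1), of x]] r(1) by simp
qed

lemma tri_sum_or_bad:
  assumes "n choose 2 > 2 * t"
  shows "tri_sum (n + 1) t \<or> (t, n) \<in> set bad_pairs"
proof (cases "t < 210")
  case True
  show ?thesis
  proof (cases "tri_table ! t \<le> n + 1")
    case True
    then show ?thesis using tri_sum_table[OF \<open>t < 210\<close>] tri_sum_mono by blast
  next
    case False
    define N where "N = tri_table ! t"
    have n: "n + 2 \<le> N" using False by (simp add: N_def)
    then have "(N - 2) * (N - 3) \<le> 4 * t \<or>
        (t, N - 2) \<in> set bad_pairs \<and> (N - 3) * (N - 4) \<le> 4 * t"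
      using tri_table_bad_check True by (auto simp: list_all_length N_def)
    moreover have "n choose 2 \<le> (N - 2) choose 2" using n by (intro choose_two_mono) simp
    moreover have "n = N - 2 \<or> n choose 2 \<le> (N - 3) choose 2"
      using n by (auto intro!: choose_two_mono)
    ultimately show ?thesis using assms by (auto simp: choose_two)
  qed
next
  case False
  then show ?thesis using tri_sum_large assms by simp
qed

section \<open>Exceptional pairs and the reducibility criterion\<close>

definition exceptions :: "(nat \<times> nat) set" where
  "exceptions = (\<lambda>(t, n). ((n choose 2) - t, n)) ` set bad_pairs"

lemma exceptions_eq:
  "exceptions = {(29, 11), (45, 13), (50, 14), (47, 14), (55, 15), (67, 16), (73, 17), (79, 18)}"
  by (simp add: exceptions_def bad_pairs_def choose_two)

lemma bad_pairs_bounds: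
  assumes "(t, n) \<in> set bad_pairs"
  shows "t < 75" "tri_table ! t = n + 2" "2 * t < n choose 2" "n choose 2 \<le> 3 * t + 1"
  using bad_pairs_check assms by (auto simp: list_all_iff choose_two)

lemma exceptionsE:
  assumes "(a, n) \<in> exceptions"
  obtains t where "n choose 2 = a + t" "t < a" "t < 75" "tri_table ! t = n + 2"
proof -
  obtain t where t: "(t, n) \<in> set bad_pairs" "a = (n choose 2) - t"
    using assms unfolding exceptions_def by auto
  then show ?thesis using bad_pairs_bounds[OF t(1)] by (intro that[of t]) auto
qed

lemma exceptionsI:
  assumes "(t, n) \<in> set bad_pairs" "n choose 2 = k * a + t" "t < a"
  shows "(a, n) \<in> exceptions"
proof -
  \<comment> \<open>From \<open>n choose 2 \<le> 3 * t + 1\<close> and \<open>t < a\<close> follows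
    \<open>k * a \<le> 2 * t + 1 < 2 * a\<close>.\<close>
  have "k * a < 2 * a" "k * a \<noteq> 0"
    using bad_pairs_bounds[OF assms(1)] assms(2,3) by linarith+
  then have "k = 1" by (cases k) auto
  then have "a = (n choose 2) - t" using assms(2) by simp
  then show ?thesis using assms(1) unfolding exceptions_def by force
qed

lemma generator_reducible_iff:
  assumes "a \<ge> 1" "b \<ge> 1"
  shows "generator_reducible a b n \<longleftrightarrow> a \<le> n choose 2 \<and> \<not> ((a, n) \<in> exceptions \<and> b = 1)"
proof
  assume "generator_reducible a b n"
  then obtain k t where kt: "k \<ge> 1" "n choose 2 = k * a + t" "tri_sum (n + k * b) t"
    unfolding generator_reducible_def by blast
  have "a \<le> k * a" using kt(1) by simp
  then have "a \<le> n choose 2" using kt(2) by linarith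
  moreover have False if exc: "(a, n) \<in> exceptions" and "b = 1"
  proof -
    obtain s where s: "n choose 2 = a + s" "s < a" "s < 75" "tri_table ! s = n + 2"
      using exc by (rule exceptionsE)
    have "k * a < 2 * a" using kt(2) s by linarith
    then have "k = 1" using kt(1) by simp
    \<comment> \<open>With \<open>k = 1\<close> and \<open>b = 1\<close> the index sum is
      \<open>n + 1\<close>, one less than the least possible value \<open>n + 2\<close>.\<close>
    then show False using tri_table_le[of "n + 1" s] kt s \<open>b = 1\<close> by simp
  qed
  ultimately show "a \<le> n choose 2 \<and> \<not> ((a, n) \<in> exceptions \<and> b = 1)" by blast
next
  assume r: "a \<le> n choose 2 \<and> \<not> ((a, n) \<in> exceptions \<and> b = 1)"
  define k t where "k = (n choose 2) div a" and "t = (n choose 2) mod a"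
  have kt: "n choose 2 = k * a + t" "t < a" using assms(1) by (simp_all add: k_def t_def)
  have k: "k \<ge> 1" using r assms(1) by (simp add: k_def div_greater_zero_iff Suc_le_eq)
  show "generator_reducible a b n"
  proof (cases "(a, n) \<in> exceptions")
    case True
    then have "(a, n) \<in> exceptions" by simp
    then obtain s where s: "n choose 2 = a + s" "s < a" "s < 75" "tri_table ! s = n + 2"
      by (rule exceptionsE)
    \<comment> \<open>For \<open>b \<ge> 2\<close> a single subtraction of \<open>a\<close> already
      allows the index sum \<open>n + 2\<close>.\<close>
    have "b \<ge> 2" using r True assms(2) by force
    then have "tri_sum (n + 1 * b) s"
      using tri_sum_table[of s] s tri_sum_mono by auto
    then show ?thesis unfolding generator_reducible_def using s(1)
      by (intro exI[of _ 1] exI[of _ s]) auto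
  next
    case False
    \<comment> \<open>Since \<open>t < a \<le> k * a\<close>, the remainder is less than half of
      \<open>n choose 2\<close>.\<close>
    have "a \<le> k * a" using k by simp
    then have "n choose 2 > 2 * t" using kt by linarith
    then have "tri_sum (n + 1) t" using tri_sum_or_bad exceptionsI[OF _ kt] False by blast
    moreover have "n + 1 \<le> n + k * b" using k assms(2) by simp
    ultimately have "tri_sum (n + k * b) t" by (rule tri_sum_mono)
    then show ?thesis unfolding generator_reducible_def using k kt(1) by blast
  qed
qed

section \<open>Counting the irreducible generators\<close>

lemma less_f_iff:
  assumes "n \<ge> 1"
  shows "real n < f (real a) \<longleftrightarrow> n choose 2 < a"
proof -
  have "real n < f (real a) \<longleftrightarrow> 2 * real n - 1 < sqrt (8 * real a + 1)"
    unfolding f_def by (simp add: field_simps)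
  \<comment> \<open>Squaring is reversible because \<open>n \<ge> 1\<close> makes
    \<open>2 * real n - 1\<close> positive.\<close>
  also have "\<dots> \<longleftrightarrow> (2 * real n - 1)\<^sup>2 < 8 * real a + 1"
    using assms real_sqrt_less_iff[of "(2 * real n - 1)\<^sup>2" "8 * real a + 1"] by simp
  also have "(2 * real n - 1)\<^sup>2 = 8 * real (n choose 2) + 1"
    using arg_cong[OF twice_choose_two[of n], of real_of_int]
    by (simp add: power2_eq_square algebra_simps)
  finally show ?thesis by simp
qed

theorem theorem9p7:
  fixes a b :: nat
  assumes "a \<ge> 1" and "b \<ge> 1" and "gcd a b = 1"
  shows "((a, b) \<in> {(29, 1), (45, 1), (47, 1), (50, 1), (55, 1), (67, 1), (73, 1), (79, 1)} \<longrightarrow>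
            int (embedding_dimension (S_monoid a b)) = \<lceil>f (real a)\<rceil>) \<and>
         ((a, b) \<notin> {(29, 1), (45, 1), (47, 1), (50, 1), (55, 1), (67, 1), (73, 1), (79, 1)} \<longrightarrow>
            int (embedding_dimension (S_monoid a b)) = \<lceil>f (real a)\<rceil> - 1)"
proof -
  define m where "m = nat \<lceil>f (real a)\<rceil>"
  define E where "E = {n. (a, n) \<in> exceptions \<and> b = 1}"
  have "f (real a) > 1" using less_f_iff[of 1 a] assms(1) by (simp add: choose_two)
  then have m: "int m = \<lceil>f (real a)\<rceil>" "m \<ge> 1" unfolding m_def by linarith+
  have less_m: "n choose 2 < a \<longleftrightarrow> n < m" if "n \<ge> 1" for n
    using less_f_iff[OF that, of a] less_ceiling_iff[of "int n" "f (real a)"] m(1)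
    by (metis of_int_of_nat_eq of_nat_less_iff)
  have E: "n \<ge> 1 \<and> a \<le> n choose 2" if "n \<in> E" for n
    using that by (auto simp: E_def exceptions_eq choose_two)
  \<comment> \<open>The indices below \<open>m\<close> give the generic count \<open>m - 1\<close>;
    \<open>E\<close> holds the extra irreducible indices, all at least \<open>m\<close>.\<close>
  have "{n. n \<ge> 1 \<and> \<not> generator_reducible a b n} = {1..<m} \<union> E"
    using generator_reducible_iff[OF assms(1,2)] less_m E by (auto simp: E_def not_le)
  moreover have "{1..<m} \<inter> E = {}" using less_m E by fastforce
  moreover have finE: "finite E"
    by (rule finite_subset[of _ "{..18}"]) (auto simp: E_def exceptions_eq)
  ultimately have "embedding_dimension (S_monoid a b) = (m - 1) + card E"
    using embedding_dimension_S_monoid[OF assms] by (simp add: card_Un_disjoint)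
  then have dim: "int (embedding_dimension (S_monoid a b)) = \<lceil>f (real a)\<rceil> - 1 + int (card E)"
    using m by simp
  show ?thesis
  proof (cases "(a, b) \<in> {(29, 1), (45, 1), (47, 1), (50, 1), (55, 1), (67, 1), (73, 1), (79, 1)}")
    case True
    \<comment> \<open>Each of the eight values of \<open>a\<close> occurs in exactly one exceptional
      pair.\<close>
    then have "\<exists>n. E = {n}" by (auto simp: E_def exceptions_eq)
    then have "card E = 1" by auto
    then show ?thesis using True dim by simp
  next
    case False
    then have "E = {}" by (auto simp: E_def exceptions_eq)
    then show ?thesis using False dim by simp
  qed
qed

end
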